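(* Let $n,m$ be positive integers with $n$ even, and let $S_n(m)=\sum_{\nu=0}^{m-1}\nu^n$. Then for $r=1$ and for $r=2$, \[ m^{r+1}\mid S_n(m)\iff m^r\mid B_n . \]
   Context: $B_n$ are the Bernoulli numbers, $\frac{z}{e^z-1}=\sum_{n\ge0}B_n\frac{z^n}{n!}$. Writing $B_n=\Lambda_n/V_n$ in lowest terms with $V_n>0$, the statement $m^r\mid B_n$ means $m^r\mid \Lambda_n$ (the numerator). *)

theory Defs
  imports "HOL-Computational_Algebra.Formal_Power_Series"
begin

text \<open>
  The Bernoulli numbers are read off from the exponential generating function
  $z / (e^z - 1)$, taken as a formal power series over the rationals. Both \<open>fps_X\<close> and
  \<open>fps_exp 1 - 1\<close> have subdegree 1, so the quotient is exact; see \<open>bernoulli_egf\<close>.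
\<close>

definition bernoulli :: "nat \<Rightarrow> rat" where
  "bernoulli n = fact n * fps_nth (fps_X / (fps_exp 1 - 1)) n"

lemma bernoulli_egf:
  "Abs_fps (\<lambda>n. bernoulli n / fact n) * (fps_exp 1 - 1) = fps_X"
proof -
  let ?g = "fps_exp 1 - 1 :: rat fps"
  have g1: "fps_nth ?g 1 = 1" and g0: "fps_nth ?g 0 = 0"
    by simp_all
  have sub: "subdegree ?g = 1"
    by (rule subdegreeI) (use g0 g1 in auto)
  have "?g dvd fps_X"
    using g1 sub by (subst fps_dvd_iff) auto
  moreover have "Abs_fps (\<lambda>n. bernoulli n / fact n) = fps_X / ?g"
    by (simp add: fps_eq_iff bernoulli_def)
  ultimately show ?thesis
    by simp
qed

text \<open>\<open>quotient_of\<close> gives the representation in lowest terms with positive denominator.\<close>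

definition bernoulli_num :: "nat \<Rightarrow> int" where
  "bernoulli_num n = fst (quotient_of (bernoulli n))"

definition power_sum :: "nat \<Rightarrow> nat \<Rightarrow> int" where
  "power_sum n m = (\<Sum>\<nu><m. int \<nu> ^ n)"

end

theory Submission
  imports Defs "HOL-Number_Theory.Number_Theory"
begin

text \<open>
  Write \<open>S\<close> for \<open>power_sum n m\<close> and \<open>B\<^sub>k\<close> for \<open>bernoulli k\<close>. Everything is compared one prime
  \<open>p\<close> dividing \<open>m\<close> at a time, using Bernoulli's formula for \<open>S\<close>, whose leading term is \<open>m B\<^sub>n\<close>;
  let \<open>v\<close> be the exponent of \<open>p\<close> in \<open>m\<close>. The formula with \<open>m = p\<close> gives inductively that
  \<open>p B\<^sub>k\<close> is \<open>p\<close>-integral, and then that \<open>B\<^sub>n\<close> is \<open>p\<close>-integral iff \<open>p - 1\<close> does not divide \<open>n\<close>.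

  If \<open>p - 1\<close> divides \<open>n\<close>, then \<open>S / m\<close> differs from the non-integral \<open>B\<^sub>n\<close> by a \<open>p\<close>-integral
  number, so neither divisibility holds. Otherwise \<open>p \<ge> 5\<close>, and \<open>S - m B\<^sub>n\<close> is divisible by
  \<open>p\<close> to the power \<open>2 v\<close>, which settles \<open>r = 1\<close>. It is divisible by \<open>p\<close> to the power \<open>3 v\<close>
  unless the term with \<open>B\<^sub>n\<^sub>-\<^sub>2\<close> interferes or \<open>n = 2\<close>, i.e. unless \<open>n \<equiv> 2\<close> modulo
  \<open>p - 1\<close> and \<open>p\<close> does not divide \<open>n\<close>. In that case a Kummer-type congruence for
  \<open>power_sum n p\<close> modulo the square of \<open>p\<close> shows that \<open>B\<^sub>n\<close> is a \<open>p\<close>-adic unit, and again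
  neither divisibility holds.
\<close>

subsection \<open>Bernoulli numbers and power sums\<close>

text \<open>Multiply the geometric sum for \<open>fps_exp (of_nat m) - 1\<close> by the generating
  series and compare coefficients at \<open>Suc n\<close>.\<close>

lemma power_sum_bernoulli:
  "of_int (power_sum n m) =
    (\<Sum>k\<le>n. of_nat (n choose k) * bernoulli (n - k) * of_nat m ^ (k + 1) / of_nat (k + 1))"
proof -
  let ?G = "Abs_fps (\<lambda>n. bernoulli n / fact n)" and ?E = "fps_exp 1 - 1 :: rat fps"
  have E: "fps_exp (of_nat m) - 1 = ?E * (\<Sum>\<nu><m. fps_exp (of_nat \<nu>))"
    using power_diff_1_eq[of "fps_exp 1 :: rat fps" m] by (simp add: fps_exp_power_mult)
  have "(fps_exp (of_nat m) - 1) * ?G = fps_X * (\<Sum>\<nu><m. fps_exp (of_nat \<nu>))"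
    unfolding E bernoulli_egf[symmetric] by (simp add: mult_ac)
  then have "fps_nth ((fps_exp (of_nat m) - 1) * ?G) (Suc n)
      = fps_nth (fps_X * (\<Sum>\<nu><m. fps_exp (of_nat \<nu>))) (Suc n)"
    by simp
  also have "\<dots> = (\<Sum>\<nu><m. of_nat \<nu> ^ n) / fact n"
    by (simp add: fps_sum_nth sum_divide_distrib)
  \<comment> \<open>The constant coefficient of \<open>fps_exp (of_nat m) - 1\<close> is 0, so the
    Cauchy product starts with the coefficient at 1.\<close>
  finally have *: "(\<Sum>k\<le>n. of_nat m ^ Suc k / fact (Suc k) * (bernoulli (n - k) / fact (n - k)))
      = (\<Sum>\<nu><m. of_nat \<nu> ^ n) / fact n"
    by (simp add: fps_mult_nth sum.atMost_Suc_shift atLeast0AtMost del: fact_Suc sum.atMost_Suc)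
  have "of_int (power_sum n m) = (\<Sum>\<nu><m. of_nat \<nu> ^ n :: rat)"
    by (simp add: power_sum_def)
  also have "\<dots> = fact n *
      (\<Sum>k\<le>n. of_nat m ^ Suc k / fact (Suc k) * (bernoulli (n - k) / fact (n - k)))"
    unfolding * by simp
  also have "\<dots> = (\<Sum>k\<le>n. of_nat (n choose k) * bernoulli (n - k) * of_nat m ^ (k + 1) / of_nat (k + 1))"
    by (auto simp: sum_distrib_left binomial_fact mult_ac intro!: sum.cong)
  finally show ?thesis .
qed

lemma bernoulli_0 [simp]: "bernoulli 0 = 1"
  using arg_cong[OF bernoulli_egf, of "\<lambda>f. fps_nth f 1"]
  by (simp add: fps_mult_nth)

lemma bernoulli_1: "bernoulli 1 = - (1 / 2)"
  using arg_cong[OF bernoulli_egf, of "\<lambda>f. fps_nth f 2"]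
  by (simp add: fps_mult_nth numeral_2_eq_2)

text \<open>The generating series satisfies G(-z) = G(z) + z, which is checked after multiplication
  by e^z - 1; compare odd coefficients.\<close>

lemma bernoulli_odd_eq_0:
  assumes "odd n" "n \<noteq> 1"
  shows "bernoulli n = 0"
proof -
  let ?G = "Abs_fps (\<lambda>n. bernoulli n / fact n)" and ?E = "fps_exp 1 :: rat fps"
  let ?G' = "?G oo (- fps_X)"
  have "?G' * ((?E - 1) oo (- fps_X)) = - fps_X"
    using arg_cong[OF bernoulli_egf, of "\<lambda>f. f oo (- fps_X)"]
    by (simp add: fps_compose_mult_distrib)
  moreover have "(?E - 1) oo (- fps_X) = fps_exp (- 1) - 1"
    by (simp add: fps_compose_sub_distrib fps_compose_uminus' fps_eq_iff)
  ultimately have *: "?G' * (fps_exp (- 1) - 1) = - fps_X"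
    by simp
  have "fps_exp (- 1) * ?E = 1"
    by (simp flip: fps_exp_add_mult)
  then have "?G' * (?E - 1) = ?G' * ?E - ?G' * (fps_exp (- 1) * ?E)"
    by (simp add: right_diff_distrib)
  also have "\<dots> = - (?G' * (fps_exp (- 1) - 1)) * ?E"
    by (simp add: algebra_simps)
  also have "\<dots> = fps_X * ?E"
    by (simp add: *)
  also have "\<dots> = (?G + fps_X) * (?E - 1)"
    using bernoulli_egf by (simp add: algebra_simps)
  finally have "?G' = ?G + fps_X"
    by simp
  then have "fps_nth ?G' n = fps_nth (?G + fps_X) n" by simp
  then show ?thesis
    using assms by (simp add: fps_compose_uminus')
qed

subsection \<open>Divisibility in the localization at a prime\<close>

text \<open>For prime \<open>p\<close>: the p-adic valuation of \<open>x\<close> is at least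
  \<open>e\<close>, so that \<open>e = 0\<close> means p-integral. The fraction need not be reduced,
  which keeps sums and products simple, and 0 needs no special case.\<close>

definition val_ge :: "nat \<Rightarrow> nat \<Rightarrow> rat \<Rightarrow> bool" where
  "val_ge p e x \<longleftrightarrow> (\<exists>a b. \<not> int p dvd b \<and> x * of_int b = of_int (int p ^ e * a))"

context
  fixes p :: nat
  assumes p: "prime p"
begin

lemma prime_int_p: "prime (int p)"
  using p by simp

lemma val_ge_add:
  assumes "val_ge p e x" "val_ge p e y"
  shows "val_ge p e (x + y)"
proof -
  obtain a b c d where *: "\<not> int p dvd b" "x * of_int b = of_int (int p ^ e * a)"
      "\<not> int p dvd d" "y * of_int d = of_int (int p ^ e * c)"
    using assms unfolding val_ge_def by blast
  have "(x + y) * of_int (b * d) = (x * of_int b) * of_int d + (y * of_int d) * of_int b"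
    by (simp add: algebra_simps)
  also have "\<dots> = of_int (int p ^ e * (a * d + c * b))"
    unfolding * by (simp add: algebra_simps)
  finally show ?thesis
    using * prime_dvd_mult_iff[OF prime_int_p, of b d] unfolding val_ge_def by blast
qed

lemma val_ge_mult:
  assumes "val_ge p d x" "val_ge p e y"
  shows "val_ge p (d + e) (x * y)"
proof -
  obtain a b a' b' where *: "\<not> int p dvd b" "x * of_int b = of_int (int p ^ d * a)"
      "\<not> int p dvd b'" "y * of_int b' = of_int (int p ^ e * a')"
    using assms unfolding val_ge_def by blast
  have "(x * y) * of_int (b * b') = (x * of_int b) * (y * of_int b')"
    by (simp add: algebra_simps)
  also have "\<dots> = of_int (int p ^ (d + e) * (a * a'))"
    unfolding * by (simp add: algebra_simps power_add)
  finally show ?thesis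
    using * prime_dvd_mult_iff[OF prime_int_p, of b b'] unfolding val_ge_def by blast
qed

lemma val_ge_mono:
  assumes "val_ge p e x" "d \<le> e"
  shows "val_ge p d x"
proof -
  obtain a b where *: "\<not> int p dvd b" "x * of_int b = of_int (int p ^ e * a)"
    using assms unfolding val_ge_def by blast
  have "int p ^ e * a = int p ^ d * (int p ^ (e - d) * a)"
    using assms(2) by (simp flip: power_add mult.assoc)
  then show ?thesis using * unfolding val_ge_def by metis
qed

lemma val_ge_of_int_iff: "val_ge p e (of_int a) \<longleftrightarrow> int p ^ e dvd a"
proof
  assume "val_ge p e (of_int a)"
  then obtain c b where *: "\<not> int p dvd b" "of_int a * of_int b = (of_int (int p ^ e * c) :: rat)"
    unfolding val_ge_def by blast
  have "a * b = int p ^ e * c"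
    using *(2) by (metis of_int_eq_iff of_int_mult)
  moreover have "coprime (int p ^ e) b"
    using *(1) prime_imp_coprime[OF prime_int_p] by simp
  ultimately show "int p ^ e dvd a"
    by (metis coprime_dvd_mult_left_iff dvd_triv_left)
next
  assume "int p ^ e dvd a"
  then obtain c where "a = int p ^ e * c" by blast
  then have "\<not> int p dvd 1 \<and> of_int a * of_int 1 = (of_int (int p ^ e * c) :: rat)"
    using prime_int_p by (auto dest: not_prime_unit)
  then show "val_ge p e (of_int a)"
    unfolding val_ge_def by blast
qed

lemma val_ge_of_int [simp]: "val_ge p 0 (of_int a)"
  by (simp add: val_ge_of_int_iff)

lemma val_ge_of_nat [simp]: "val_ge p 0 (of_nat a)"
  using val_ge_of_int[of "int a"] by simp

lemma val_ge_0 [simp]: "val_ge p e 0"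
  using val_ge_of_int_iff[of e 0] by simp

lemma val_ge_int_mult:
  assumes "val_ge p e x" shows "val_ge p e (of_int a * x)"
  using val_ge_mult[OF val_ge_of_int assms] by simp

lemma val_ge_uminus_iff [simp]: "val_ge p e (- x) \<longleftrightarrow> val_ge p e x"
  using val_ge_int_mult[of e x "- 1"] val_ge_int_mult[of e "- x" "- 1"] by auto

lemma val_ge_diff:
  assumes "val_ge p e x" "val_ge p e y"
  shows "val_ge p e (x - y)"
  using val_ge_add[of e x "- y"] assms by simp

lemma val_ge_diff_cong:
  assumes "val_ge p e (x - y)"
  shows "val_ge p e x \<longleftrightarrow> val_ge p e y"
  using val_ge_add[of e "x - y" y] val_ge_diff[of e x "x - y"] assms by auto

lemma val_ge_sum:
  assumes "\<And>k. k \<in> A \<Longrightarrow> val_ge p e (f k)"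
  shows "val_ge p e (sum f A)"
  using assms by (induction A rule: infinite_finite_induct) (auto intro: val_ge_add)

text \<open>The factor has the shape \<open>p ^ d * c\<close> so that any positive integer, such as
  \<open>m\<close> or a multiple of \<open>k + 1\<close>, can be divided out.\<close>

lemma val_ge_cancel:
  assumes "val_ge p (d + e) (of_nat (p ^ d * c) * x)" "\<not> p dvd c"
  shows "val_ge p e x"
proof -
  obtain a b where *: "\<not> int p dvd b"
      "of_nat (p ^ d * c) * x * of_int b = of_int (int p ^ (d + e) * a)"
    using assms unfolding val_ge_def by blast
  have "(of_nat p ^ d :: rat) \<noteq> 0"
    using p by (simp add: prime_gt_0_nat)
  moreover have "of_nat p ^ d * (x * of_int (int c * b)) = of_nat p ^ d * of_int (int p ^ e * a)"
    using *(2) by (simp add: power_add mult_ac)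
  ultimately have "x * of_int (int c * b) = of_int (int p ^ e * a)"
    by (metis mult_left_cancel)
  moreover have "\<not> int p dvd int c * b"
    using * assms(2) prime_dvd_mult_iff[OF prime_int_p] by simp
  ultimately show ?thesis
    unfolding val_ge_def by blast
qed

lemma val_ge_prime_power_mult_iff:
  assumes "\<not> p dvd c"
  shows "val_ge p (d + e) (of_nat (p ^ d * c) * x) \<longleftrightarrow> val_ge p e x"
proof
  assume "val_ge p e x"
  moreover have "val_ge p d (of_nat (p ^ d * c))"
    using val_ge_of_int_iff[of d "int (p ^ d * c)"] by simp
  ultimately show "val_ge p (d + e) (of_nat (p ^ d * c) * x)"
    by (rule val_ge_mult[rotated])
qed (use val_ge_cancel assms in blast)

text \<open>A positive \<open>e\<close> makes \<open>p\<close> divide the numerator, hence not the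
  denominator. For \<open>e = 0\<close> the right side would hold for every
  \<open>x\<close>.\<close>

lemma val_ge_iff_dvd_numerator:
  assumes "0 < e"
  shows "val_ge p e x \<longleftrightarrow> int p ^ e dvd fst (quotient_of x)"
proof -
  obtain a b where q: "quotient_of x = (a, b)" by fastforce
  have b: "b > 0" and ab: "coprime a b" and x: "x * of_int b = of_int a"
    using quotient_of_denom_pos[OF q] quotient_of_coprime[OF q] quotient_of_div[OF q] by auto
  show ?thesis
  proof
    assume "val_ge p e x"
    then show "int p ^ e dvd fst (quotient_of x)"
      using val_ge_int_mult[of e x b] x q val_ge_of_int_iff[of e a] by (simp add: mult.commute)
  next
    assume "int p ^ e dvd fst (quotient_of x)"
    then have *: "int p ^ e dvd a" using q by simp
    then have "int p dvd a"
      using assms by (meson dvd_power dvd_trans)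
    then have "\<not> int p dvd b"
      using ab prime_int_p by (meson coprime_common_divisor not_prime_unit)
    moreover obtain c where "a = int p ^ e * c" using * by blast
    ultimately show "val_ge p e x"
      unfolding val_ge_def using x by blast
  qed
qed

end

subsection \<open>Power sums modulo a prime and its square\<close>

text \<open>Multiplication by \<open>a\<close> permutes the residues modulo \<open>p\<close>. The
  separate modulus \<open>M\<close> allows values of \<open>f\<close> to be compared modulo the
  square of \<open>p\<close>.\<close>

lemma sum_mult_permutes_residues:
  fixes f :: "int \<Rightarrow> int"
  assumes "prime p" "\<not> p dvd a"
    and f: "\<And>x y. [x = y] (mod int p) \<Longrightarrow> [f x = f y] (mod M)"
  shows "[(\<Sum>j<p. f (int a * int j)) = (\<Sum>j<p. f (int j))] (mod M)"
proof -
  have inj: "inj_on (\<lambda>j. a * j mod p) {..<p}"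
  proof (rule inj_onI)
    fix x y assume "x \<in> {..<p}" "y \<in> {..<p}" "a * x mod p = a * y mod p"
    then have "[x = y] (mod p)"
      using assms(1,2) by (metis cong_def cong_mult_lcancel_nat coprime_commute prime_imp_coprime)
    then show "x = y"
      using \<open>x \<in> _\<close> \<open>y \<in> _\<close> cong_less_modulus_unique_nat by auto
  qed
  moreover have "(\<lambda>j. a * j mod p) ` {..<p} \<subseteq> {..<p}"
    using assms(1) prime_gt_0_nat by auto
  ultimately have img: "(\<lambda>j. a * j mod p) ` {..<p} = {..<p}"
    by (intro endo_inj_surj) auto
  have "[(\<Sum>j<p. f (int a * int j)) = (\<Sum>j<p. f (int (a * j mod p)))] (mod M)"
    by (intro cong_sum f) (simp add: cong_def zmod_int)
  also have "(\<Sum>j<p. f (int (a * j mod p))) = (\<Sum>j<p. f (int j))"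
    using sum.reindex[OF inj, of "\<lambda>j. f (int j)"] img by simp
  finally show ?thesis .
qed

lemma fermat_int:
  assumes "prime p" "0 < j" "j < p"
  shows "[int j ^ (p - 1) = 1] (mod int p)"
proof -
  have "\<not> p dvd j" using assms by (simp add: nat_dvd_not_less)
  then show ?thesis
    using fermat_theorem[OF assms(1)] by (metis cong_int_iff of_nat_1 of_nat_power)
qed

text \<open>If \<open>p - 1\<close> divides \<open>n\<close>, Fermat turns every nonzero summand
  into 1. Otherwise, for a primitive root \<open>g\<close>, the sum is unchanged modulo
  \<open>p\<close> by the factor \<open>g ^ n\<close>, which is not 1.\<close>

lemma prime_dvd_power_sum_iff:
  assumes p: "prime p" and "0 < n"
  shows "int p dvd power_sum n p \<longleftrightarrow> \<not> (p - 1) dvd n"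
proof (cases "(p - 1) dvd n")
  case True
  have p1: "p > 1" using p by (rule prime_gt_1_nat)
  have "[int j ^ n = (if j = 0 then 0 else 1)] (mod int p)" if "j < p" for j
  proof (cases "j = 0")
    case False
    obtain k where "n = (p - 1) * k" using True by blast
    then show ?thesis
      using cong_pow[OF fermat_int[OF p _ that], of k] False by (simp add: power_mult)
  qed (use assms in \<open>simp add: power_0_left\<close>)
  then have "[power_sum n p = (\<Sum>j<p. if j = 0 then 0 else 1)] (mod int p)"
    unfolding power_sum_def by (intro cong_sum) auto
  also have "(\<Sum>j<p. if j = 0 then 0 else 1) = (\<Sum>j\<in>{..<p} - {0}. 1::int)"
    by (intro sum.mono_neutral_cong_right) auto
  also have "\<dots> = int p - 1"
    using p1 by simp
  finally have "[power_sum n p = int p - 1] (mod int p)" .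
  moreover have "\<not> int p dvd int p - 1"
    using p1 by (simp add: zdvd_not_zless)
  ultimately have "\<not> int p dvd power_sum n p"
    using cong_dvd_iff by blast
  then show ?thesis using True by simp
next
  case False
  obtain g where g: "residue_primroot p g"
    using prime_primitive_root_exists[of p] p prime_gt_1_nat by auto
  have cop: "coprime p g" and "ord p g = p - 1"
    using g p by (auto simp: residue_primroot_def totient_prime)
  then have "\<not> [g ^ n = 1] (mod p)"
    using False ord_divides by metis
  then have nd: "\<not> int p dvd int g ^ n - 1"
    by (metis cong_iff_dvd_diff cong_int_iff of_nat_1 of_nat_power)
  have "\<not> p dvd g"
    using cop p by (metis coprime_absorb_left not_prime_unit)
  from sum_mult_permutes_residues[OF p this, of "\<lambda>x. x ^ n" "int p"]
  have "[int g ^ n * power_sum n p = power_sum n p] (mod int p)"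
    by (simp add: cong_pow power_mult_distrib power_sum_def sum_distrib_left)
  then have "int p dvd (int g ^ n - 1) * power_sum n p"
    by (simp add: cong_iff_dvd_diff algebra_simps)
  then show ?thesis
    using nd False p prime_dvd_mult_iff[of "int p"] by simp
qed

lemma power_sum_2: "6 * power_sum 2 (Suc m) = int m * (int m + 1) * (2 * int m + 1)"
  by (induction m) (simp_all add: power_sum_def algebra_simps power2_eq_square)

lemma cong_binomial_square:
  fixes x :: int
  shows "[(1 + q * x) ^ k = 1 + int k * (q * x)] (mod q\<^sup>2)"
proof (induction k)
  case (Suc k)
  have "[(1 + q * x) * (1 + q * x) ^ k = (1 + q * x) * (1 + int k * (q * x))] (mod q\<^sup>2)"
    by (intro cong_mult Suc cong_refl)
  also have "(1 + q * x) * (1 + int k * (q * x)) = 1 + int (Suc k) * (q * x) + q\<^sup>2 * (int k * x\<^sup>2)"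
    by (simp add: algebra_simps power2_eq_square)
  also have "[\<dots> = 1 + int (Suc k) * (q * x)] (mod q\<^sup>2)"
    by (simp add: cong_iff_dvd_diff)
  finally show ?case by simp
qed simp

text \<open>Each factor of \<open>x ^ p - y ^ p = (x - y) * (...)\<close> contributes one
  \<open>p\<close>: the second is a sum of \<open>p\<close> terms all congruent to
  \<open>y ^ (p - 1)\<close>.\<close>

lemma cong_power_prime_square:
  fixes x y :: int
  assumes "[x = y] (mod int p)"
  shows "[x ^ p = y ^ p] (mod (int p)\<^sup>2)"
proof -
  have "x ^ p - y ^ p = (x - y) * (\<Sum>i<p. y ^ (p - Suc i) * x ^ i)"
    by (rule power_diff_sumr2)
  moreover have "int p dvd x - y"
    using assms by (simp add: cong_iff_dvd_diff)
  moreover have "[(\<Sum>i<p. y ^ (p - Suc i) * x ^ i) = (\<Sum>i<p. y ^ (p - 1))] (mod int p)"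
  proof (intro cong_sum)
    fix i assume "i \<in> {..<p}"
    then have "y ^ (p - 1) = y ^ (p - Suc i) * y ^ i"
      by (simp flip: power_add)
    then show "[y ^ (p - Suc i) * x ^ i = y ^ (p - 1)] (mod int p)"
      using assms by (simp add: cong_mult cong_pow)
  qed
  then have "int p dvd (\<Sum>i<p. y ^ (p - Suc i) * x ^ i)"
    by (simp add: cong_dvd_iff)
  ultimately show ?thesis
    by (simp add: cong_iff_dvd_diff power2_eq_square mult_dvd_mono)
qed

text \<open>
  Modulo \<open>p\<^sup>2\<close> the power \<open>x ^ p\<close> depends only on \<open>x\<close> modulo \<open>p\<close>, so \<open>x \<mapsto> 2 * x\<close> permutes
  the summands of \<open>power_sum (2 * p) p\<close> up to the factor \<open>4 ^ p\<close>.
\<close>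
lemma square_dvd_power_sum_double:
  assumes p: "prime p" "5 \<le> p"
  shows "(int p)\<^sup>2 dvd power_sum (2 * p) p"
proof -
  have "\<not> p dvd 2" using p by (auto dest: dvd_imp_le)
  moreover have "[x ^ (2 * p) = y ^ (2 * p)] (mod (int p)\<^sup>2)" if "[x = y] (mod int p)" for x y
    using cong_pow[OF cong_power_prime_square[OF that], of 2] by (simp add: power_mult mult.commute)
  ultimately have "[4 ^ p * power_sum (2 * p) p = power_sum (2 * p) p] (mod (int p)\<^sup>2)"
    using sum_mult_permutes_residues[OF p(1), of 2 "\<lambda>x. x ^ (2 * p)" "(int p)\<^sup>2"]
    by (simp add: power_mult_distrib power_sum_def sum_distrib_left power_mult)
  then have "(int p)\<^sup>2 dvd (4 ^ p - 1) * power_sum (2 * p) p"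
    by (simp add: cong_iff_dvd_diff algebra_simps)
  \<comment> \<open>By Fermat \<open>4 ^ p - 1\<close> is congruent to 3 modulo \<open>p\<close>,
    and \<open>p\<close> is at least 5.\<close>
  moreover have "coprime ((int p)\<^sup>2) (4 ^ p - 1)"
  proof -
    have "[4 ^ p = 4 * 4 ^ (p - 1)] (mod int p)"
      using p by (metis cong_refl power_eq_if not_numeral_le_zero)
    also have "[4 * 4 ^ (p - 1) = 4 * 1] (mod int p)"
      using fermat_int[OF p(1), of 4] p by (intro cong_mult) auto
    finally have "[4 ^ p - 1 = 4 - 1] (mod int p)"
      by (metis cong_diff cong_refl mult.right_neutral)
    moreover have "\<not> int p dvd 3" using p by (auto dest: zdvd_imp_le)
    ultimately have "\<not> int p dvd 4 ^ p - 1"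
      using cong_dvd_iff by fastforce
    then show ?thesis
      using p prime_imp_coprime[of "int p"] by simp
  qed
  ultimately show ?thesis
    by (simp add: coprime_dvd_mult_right_iff)
qed

text \<open>Modulo the square of \<open>p\<close>, \<open>j ^ (2 + i * (p - 1))\<close> is linear in
  \<open>i\<close>. Interpolate between \<open>i = 0\<close> and \<open>i = 2\<close>; the latter
  has exponent \<open>2 * p\<close>, whose power sum vanishes.\<close>

lemma power_sum_cong_2:
  assumes p: "prime p" "5 \<le> p" and n: "n = 2 + k * (p - 1)"
  shows "[2 * power_sum n p = (2 - int k) * power_sum 2 p] (mod (int p)\<^sup>2)"
proof -
  have *: "[int j ^ (2 + i * (p - 1)) = int j ^ 2 + int i * (int j ^ 2 * (int j ^ (p - 1) - 1))]
      (mod (int p)\<^sup>2)" if "j < p" for i j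
  proof (cases "j = 0")
    case False
    then have "int p dvd int j ^ (p - 1) - 1"
      using fermat_int[OF p(1), of j] that by (simp add: cong_iff_dvd_diff)
    then obtain w where w: "int j ^ (p - 1) - 1 = int p * w" by blast
    then have "int j ^ (p - 1) = 1 + int p * w" by simp
    then have "int j ^ (2 + i * (p - 1)) = int j ^ 2 * (1 + int p * w) ^ i"
      by (metis power_add power_mult mult.commute)
    also have "[\<dots> = int j ^ 2 * (1 + int i * (int p * w))] (mod (int p)\<^sup>2)"
      by (intro cong_mult cong_binomial_square cong_refl)
    also have "int j ^ 2 * (1 + int i * (int p * w))
        = int j ^ 2 + int i * (int j ^ 2 * (int j ^ (p - 1) - 1))"
      unfolding w by (simp add: algebra_simps)
    finally show ?thesis .
  qed (use p in \<open>auto simp: power_0_left\<close>)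
  have 2: "2 * p = 2 + 2 * (p - 1)" using p by simp
  have "[2 * int j ^ n - int k * int j ^ (2 * p) = (2 - int k) * int j ^ 2] (mod (int p)\<^sup>2)"
    if "j < p" for j
  proof -
    let ?w = "int j ^ 2 * (int j ^ (p - 1) - 1)"
    have "[2 * int j ^ n - int k * int j ^ (2 * p)
        = 2 * (int j ^ 2 + int k * ?w) - int k * (int j ^ 2 + int 2 * ?w)] (mod (int p)\<^sup>2)"
      unfolding n 2 by (intro cong_diff cong_mult cong_refl * that)
    also have "2 * (int j ^ 2 + int k * ?w) - int k * (int j ^ 2 + int 2 * ?w)
        = (2 - int k) * int j ^ 2"
      by (simp add: algebra_simps)
    finally show ?thesis .
  qed
  then have "[(\<Sum>j<p. 2 * int j ^ n - int k * int j ^ (2 * p))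
      = (\<Sum>j<p. (2 - int k) * int j ^ 2)] (mod (int p)\<^sup>2)"
    by (intro cong_sum) auto
  then have 1: "[2 * power_sum n p - int k * power_sum (2 * p) p
      = (2 - int k) * power_sum 2 p] (mod (int p)\<^sup>2)"
    by (simp add: power_sum_def sum_subtractf sum_distrib_left)
  have 2: "[2 * power_sum n p - int k * power_sum (2 * p) p = 2 * power_sum n p] (mod (int p)\<^sup>2)"
    using square_dvd_power_sum_double[OF p] by (simp add: cong_iff_dvd_diff)
  show ?thesis
    using cong_trans[OF cong_sym[OF 2] 1] .
qed

text \<open>By its closed form \<open>power_sum 2 p\<close> contains \<open>p\<close> exactly once,
  and \<open>2 - k\<close> is congruent to \<open>n\<close> modulo \<open>p\<close>.\<close>

lemma not_square_dvd_power_sum: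
  assumes p: "prime p" "5 \<le> p" and n: "2 \<le> n" "(p - 1) dvd (n - 2)" "\<not> p dvd n"
  shows "\<not> (int p)\<^sup>2 dvd power_sum n p"
proof
  assume *: "(int p)\<^sup>2 dvd power_sum n p"
  obtain k where "n - 2 = (p - 1) * k" using n(2) by blast
  then have k: "n = 2 + k * (p - 1)" using n(1) by (simp add: mult.commute)
  have pp: "prime (int p)" using p by simp
  have "(int p)\<^sup>2 dvd (2 - int k) * power_sum 2 p"
    using power_sum_cong_2[OF p k] * by (metis cong_dvd_iff dvd_mult)
  then have "(int p)\<^sup>2 dvd 6 * ((2 - int k) * power_sum 2 p)"
    by (rule dvd_mult)
  also have "6 * ((2 - int k) * power_sum 2 p) = (2 - int k) * (6 * power_sum 2 (Suc (p - 1)))"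
    using p by simp
  also have "\<dots> = int p * ((2 - int k) * (int p - 1) * (2 * int p - 1))"
    unfolding power_sum_2 using p by (simp add: of_nat_diff algebra_simps)
  finally have "int p dvd (2 - int k) * (int p - 1) * (2 * int p - 1)"
    using p by (simp add: power2_eq_square)
  moreover have "\<not> int p dvd 2 - int k"
  proof -
    have "int n = (2 - int k) + int p * int k"
      using p by (simp add: k of_nat_diff algebra_simps)
    then show ?thesis using n(3) by (metis dvd_add dvd_triv_left of_nat_dvd_iff)
  qed
  moreover have "\<not> int p dvd int p - 1" "\<not> int p dvd 2 * int p - 1"
    using not_prime_unit pp by (auto simp: dvd_diff_right_iff)
  ultimately show False
    using prime_dvd_mult_iff[OF pp] by blast
qed

subsection \<open>Divisibility by a power, prime by prime\<close>

lemma power_dvd_iff_prime_powers: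
  fixes m s :: nat and a :: int
  assumes "0 < m"
  shows "int m ^ s dvd a \<longleftrightarrow>
    (\<forall>p. prime p \<and> p dvd m \<longrightarrow> int p ^ (s * multiplicity p m) dvd a)"
proof
  assume *: "int m ^ s dvd a"
  show "\<forall>p. prime p \<and> p dvd m \<longrightarrow> int p ^ (s * multiplicity p m) dvd a"
  proof (intro allI impI)
    fix p
    have "(p ^ multiplicity p m) ^ s dvd m ^ s"
      by (intro dvd_power_same multiplicity_dvd)
    then have "int (p ^ (s * multiplicity p m)) dvd int (m ^ s)"
      by (simp only: of_nat_dvd_iff) (simp add: power_mult[symmetric] mult.commute)
    then show "int p ^ (s * multiplicity p m) dvd a"
      using * by (simp add: dvd_trans)
  qed
next
  assume *: "\<forall>p. prime p \<and> p dvd m \<longrightarrow> int p ^ (s * multiplicity p m) dvd a"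
  show "int m ^ s dvd a"
  proof (cases "a = 0")
    case False
    have "m ^ s dvd nat \<bar>a\<bar>"
    proof (rule multiplicity_le_imp_dvd)
      fix p :: nat
      assume p: "prime p"
      show "multiplicity p (m ^ s) \<le> multiplicity p (nat \<bar>a\<bar>)"
      proof (cases "p dvd m")
        case True
        then have "int (p ^ (s * multiplicity p m)) dvd a"
          using * p by simp
        then have "p ^ (s * multiplicity p m) dvd nat \<bar>a\<bar>"
          by (simp add: dvd_nat_abs_iff)
        then show ?thesis
          using p assms False
          by (intro multiplicity_geI)
            (auto simp: prime_elem_multiplicity_power_distrib not_prime_unit)
      next
        case False
        then show ?thesis
          using p assms by (simp add: prime_elem_multiplicity_power_distrib not_dvd_imp_multiplicity_0)
      qed
    qed (use assms in simp)
    then have "int (m ^ s) dvd int (nat \<bar>a\<bar>)"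
      by (simp only: of_nat_dvd_iff)
    then show ?thesis by simp
  qed simp
qed

subsection \<open>The terms of Bernoulli's formula\<close>

definition bernoulli_term :: "nat \<Rightarrow> nat \<Rightarrow> nat \<Rightarrow> rat" where
  "bernoulli_term n m k =
    of_nat (n choose k) * bernoulli (n - k) * of_nat m ^ (k + 1) / of_nat (k + 1)"

lemma power_sum_diff_bernoulli:
  "of_int (power_sum n m) - of_nat m * bernoulli n = (\<Sum>k=1..n. bernoulli_term n m k)"
proof -
  have "of_int (power_sum n m) = (\<Sum>k=0..n. bernoulli_term n m k)"
    by (simp add: power_sum_bernoulli bernoulli_term_def atLeast0AtMost)
  also have "\<dots> = of_nat m * bernoulli n + (\<Sum>k=1..n. bernoulli_term n m k)"
    by (subst sum.atLeast_Suc_atMost) (simp_all add: bernoulli_term_def mult.commute)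
  finally show ?thesis by simp
qed

text \<open>Bounds the powers of \<open>p\<close> lost to the denominator \<open>k + 1\<close>,
  since \<open>p ^ j\<close> outgrows \<open>j\<close>.\<close>

lemma prime_power_le_imp_exponent_le:
  fixes p j k :: nat
  assumes "prime p" "p ^ j \<le> k + 1"
  shows "j \<le> k" and "2 \<le> k \<Longrightarrow> j + 1 \<le> k" and "5 \<le> p \<Longrightarrow> 3 \<le> k \<Longrightarrow> j + 3 \<le> k"
proof -
  have "2 ^ j \<le> p ^ j"
    using prime_ge_2_nat[OF assms(1)] by (rule power_mono) simp
  with assms(2) have 2: "2 ^ j \<le> k + 1" by simp
  show "j \<le> k"
    using 2 less_exp[of j] by linarith
  show "j + 1 \<le> k" if "2 \<le> k"
  proof (cases "j \<le> 1")
    case False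
    then obtain i where i: "j = i + 2"
      using le_Suc_ex[of 2 j] by (auto simp: add.commute)
    have "i + 4 \<le> 2 ^ (i + 2)" by (induction i) auto
    then show ?thesis using 2 i by simp
  qed (use that in simp)
  show "j + 3 \<le> k" if "5 \<le> p" "3 \<le> k"
  proof (cases "j = 0")
    case False
    have "4 * j + 1 \<le> 5 ^ j"
      by (induction j) auto
    also have "5 ^ j \<le> p ^ j"
      using that by (intro power_mono) auto
    finally show ?thesis using False assms(2) by linarith
  qed (use that in simp)
qed

context
  fixes p :: nat
  assumes p: "prime p"
begin

text \<open>Of the \<open>(k + 1) * v\<close> powers of \<open>p\<close> in the power of
  \<open>m\<close>, at most \<open>s\<close> are lost to \<open>B\<close> and \<open>j\<close> to
  \<open>k + 1\<close>. \<open>B\<close> is arbitrary so that it can absorb a factor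
  \<open>p\<close> of the binomial coefficient.\<close>

lemma val_ge_bernoulli_term:
  assumes B: "val_ge p 0 (of_nat (p ^ s) * B)"
    and k: "k + 1 = p ^ j * c" "\<not> p dvd c"
    and m: "p ^ v dvd m" and e: "e + s + j \<le> (k + 1) * v"
  shows "val_ge p e (of_nat N * B * of_nat m ^ (k + 1) / of_nat (k + 1))" (is "val_ge p e ?x")
proof -
  have "int p ^ ((k + 1) * v) dvd int m ^ (k + 1)"
    using dvd_power_same[OF m, of "k + 1"]
    by (metis int_dvd_int_iff mult.commute of_nat_power power_mult)
  then have "val_ge p ((k + 1) * v) (of_nat m ^ (k + 1))"
    using val_ge_of_int_iff[OF p, of _ "int m ^ (k + 1)"] by simp
  moreover have "val_ge p 0 (of_nat N * (of_nat (p ^ s) * B))"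
    using val_ge_mult[OF p val_ge_of_nat[OF p] B] by simp
  ultimately have "val_ge p ((k + 1) * v) (of_nat N * (of_nat (p ^ s) * B) * of_nat m ^ (k + 1))"
    using val_ge_mult[OF p] by fastforce
  also have "of_nat N * (of_nat (p ^ s) * B) * of_nat m ^ (k + 1) = of_nat (p ^ (s + j) * c) * ?x"
  proof -
    have "of_nat (p ^ (s + j) * c) * ?x = of_nat (p ^ s) * (of_nat (k + 1) * ?x)"
      unfolding k(1) by (simp add: power_add mult_ac)
    also have "of_nat (k + 1) * ?x = of_nat N * B * of_nat m ^ (k + 1)"
      by (simp del: of_nat_Suc of_nat_add)
    finally show ?thesis by (simp add: mult_ac)
  qed
  finally have "val_ge p ((s + j) + e) (of_nat (p ^ (s + j) * c) * ?x)"
    by (rule val_ge_mono[OF p]) (use e in simp)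
  then show ?thesis
    using k(2) by (rule val_ge_cancel[OF p])
qed

lemma prime_power_decompose:
  assumes "0 < (k::nat)"
  obtains j c where "k = p ^ j * c" "\<not> p dvd c" "p ^ j \<le> k"
proof -
  have "k \<noteq> 0" "\<not> is_unit p" using assms p by (auto simp: not_prime_unit)
  then obtain c where c: "k = p ^ multiplicity p k * c" "\<not> p dvd c"
    by (rule multiplicity_decompose')
  moreover have "p ^ multiplicity p k \<le> k"
    using assms by (intro dvd_imp_le multiplicity_dvd)
  ultimately show ?thesis using that by blast
qed

text \<open>In the formula for \<open>power_sum n p\<close> the terms with \<open>k > 0\<close> are
  p-integral by induction, so the remaining term \<open>p * bernoulli n\<close> is too.\<close>

lemma val_ge_prime_mult_bernoulli: "val_ge p 0 (of_nat p * bernoulli n)"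
proof (induction n rule: less_induct)
  case (less n)
  have "val_ge p 0 (bernoulli_term n p k)" if k: "k \<in> {1..n}" for k
  proof -
    obtain j c where "k + 1 = p ^ j * c" "\<not> p dvd c" "p ^ j \<le> k + 1"
      using prime_power_decompose[of "k + 1"] by auto
    then show ?thesis
      unfolding bernoulli_term_def using less[of "n - k"] k prime_power_le_imp_exponent_le(1)[OF p, of j k]
      by (intro val_ge_bernoulli_term[where s = 1 and v = 1 and j = j and c = c]) auto
  qed
  then have "val_ge p 0 (of_int (power_sum n p) - of_nat p * bernoulli n)"
    unfolding power_sum_diff_bernoulli by (intro val_ge_sum[OF p])
  from val_ge_diff_cong[OF p this] show ?case
    by (simp add: val_ge_of_int[OF p])
qed

lemma val_ge_power_sum_diff:
  assumes n: "0 < n" "even n" and m: "p ^ v dvd m" "0 < v"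
  shows "val_ge p v (of_int (power_sum n m) - of_nat m * bernoulli n)"
  unfolding power_sum_diff_bernoulli
proof (rule val_ge_sum[OF p])
  fix k assume k: "k \<in> {1..n}"
  show "val_ge p v (bernoulli_term n m k)"
  proof (cases "k = 1")
    case True
    \<comment> \<open>For \<open>p = 2\<close> and \<open>v = 1\<close> the general bound is too
      weak here. Evenness of \<open>n\<close> cancels the denominator 2; one \<open>m\<close> then
      makes \<open>bernoulli (n - 1)\<close> p-integral and the other supplies
      \<open>p ^ v\<close>.\<close>
    obtain l where l: "n = 2 * l" using n by blast
    have "bernoulli_term n m k = of_nat l * bernoulli (n - 1) * of_nat m ^ (1 + 0) / of_nat (0 + 1) * of_nat m"
      using True by (simp add: bernoulli_term_def l power2_eq_square)
    moreover have "val_ge p v (of_nat m)"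
      using m val_ge_of_int_iff[OF p, of v "int m"] by (metis int_dvd_int_iff of_int_of_nat_eq of_nat_power)
    moreover have "val_ge p 0 (of_nat l * bernoulli (n - 1) * of_nat m ^ (0 + 1) / of_nat (0 + 1))"
      using m p val_ge_prime_mult_bernoulli
      by (intro val_ge_bernoulli_term[where s = 1 and v = v and j = 0 and c = 1]) auto
    ultimately show ?thesis
      using val_ge_mult[OF p] by fastforce
  next
    case False
    obtain j c where j: "k + 1 = p ^ j * c" "\<not> p dvd c" "p ^ j \<le> k + 1"
      using prime_power_decompose[of "k + 1"] by auto
    then have "j + 1 \<le> k"
      using prime_power_le_imp_exponent_le(2)[OF p] k False by simp
    also have "k \<le> k * v" using m by simp
    finally have "v + 1 + j \<le> (k + 1) * v" by simp
    then show ?thesis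
      unfolding bernoulli_term_def
      by (rule val_ge_bernoulli_term[OF _ j(1,2) m(1), rotated])
        (simp add: val_ge_prime_mult_bernoulli)
  qed
qed

text \<open>Modulo \<open>p\<close>, \<open>power_sum n p\<close> agrees with
  \<open>p * bernoulli n\<close>.\<close>

lemma val_ge_bernoulli_iff:
  assumes "0 < n" "even n"
  shows "val_ge p 0 (bernoulli n) \<longleftrightarrow> \<not> (p - 1) dvd n"
proof -
  have "val_ge p 1 (of_int (power_sum n p)) \<longleftrightarrow> val_ge p (1 + 0) (of_nat (p ^ 1 * 1) * bernoulli n)"
    using val_ge_diff_cong[OF p val_ge_power_sum_diff[OF assms, of 1 p]] by simp
  also have "\<dots> \<longleftrightarrow> val_ge p 0 (bernoulli n)"
    using p by (intro val_ge_prime_power_mult_iff) auto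
  finally show ?thesis
    using prime_dvd_power_sum_iff[OF p assms(1)] by (simp add: val_ge_of_int_iff[OF p])
qed

section \<open>Sharper error estimates for primes at least 5\<close>

context
  fixes n v m :: nat
  assumes p5: "5 \<le> p" and n: "0 < n" "even n" and m: "p ^ v dvd m" "0 < v"
begin

text \<open>The loss of at most \<open>j + 1\<close> is covered by the \<open>(k - 2) * v\<close>
  powers of \<open>p\<close> beyond \<open>3 * v\<close>.\<close>

lemma val_ge_bernoulli_term_ge_3:
  assumes "3 \<le> k"
  shows "val_ge p (3 * v) (bernoulli_term n m k)"
proof -
  obtain j c where j: "k + 1 = p ^ j * c" "\<not> p dvd c" "p ^ j \<le> k + 1"
    using prime_power_decompose[of "k + 1"] by auto
  have "j + 3 \<le> k"
    using prime_power_le_imp_exponent_le(3)[OF p j(3) p5 assms] .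
  then have "j + 1 \<le> (k - 2) * v"
    using m(2) mult_le_mono2[of 1 v "k - 2"] by linarith
  moreover have "(k + 1) * v = 3 * v + (k - 2) * v"
    using assms by (simp flip: add_mult_distrib)
  ultimately have "3 * v + 1 + j \<le> (k + 1) * v" by simp
  then show ?thesis
    unfolding bernoulli_term_def
    by (rule val_ge_bernoulli_term[OF _ j(1,2) m(1), rotated])
      (simp add: val_ge_prime_mult_bernoulli)
qed

lemma not_dvd_2_3: "\<not> p dvd 2" "\<not> p dvd 3"
  using p5 by (auto dest: dvd_imp_le)

text \<open>\<open>bernoulli (n - 1)\<close> is -1/2 or 0, and \<open>p\<close> is odd.\<close>

lemma val_ge_bernoulli_term_1: "val_ge p (2 * v) (bernoulli_term n m 1)"
proof -
  have "val_ge p 0 (bernoulli (n - 1))"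
  proof (cases "n = 2")
    case True
    have "val_ge p (0 + 0) (of_nat (p ^ 0 * 2) * bernoulli 1)"
      using val_ge_of_int[OF p, of "- 1"] by (simp add: bernoulli_1[simplified])
    then show ?thesis
      using val_ge_cancel[OF p _ not_dvd_2_3(1), of 0 0 "bernoulli 1"] True by simp
  next
    case False
    then have "bernoulli (n - 1) = 0"
      using n by (intro bernoulli_odd_eq_0) auto
    then show ?thesis by (simp add: val_ge_0[OF p])
  qed
  then show ?thesis
    unfolding bernoulli_term_def using not_dvd_2_3 m
    by (intro val_ge_bernoulli_term[where s = 0 and v = v and j = 0 and c = 2]) auto
qed

lemma val_ge_power_sum_diff_2:
  "val_ge p (2 * v) (of_int (power_sum n m) - of_nat m * bernoulli n)"
  unfolding power_sum_diff_bernoulli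
proof (rule val_ge_sum[OF p])
  fix k assume k: "k \<in> {1..n}"
  consider "k = 1" | "k = 2" | "3 \<le> k" using k by fastforce
  then show "val_ge p (2 * v) (bernoulli_term n m k)"
  proof cases
    \<comment> \<open>The cube of \<open>m\<close> gives \<open>3 * v\<close>, and at most one power
      is lost to \<open>bernoulli (n - 2)\<close>.\<close>
    case 2
    then show ?thesis
      unfolding bernoulli_term_def using not_dvd_2_3 m val_ge_prime_mult_bernoulli
      by (intro val_ge_bernoulli_term[where s = 1 and v = v and j = 0 and c = 3]) auto
  qed (use val_ge_bernoulli_term_1 val_ge_mono[OF p val_ge_bernoulli_term_ge_3] in auto)
qed

text \<open>The term \<open>k = 1\<close> vanishes. For \<open>k = 2\<close> no power may be lost:
  either \<open>n choose 2\<close> supplies a factor \<open>p\<close>, or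
  \<open>bernoulli (n - 2)\<close> is itself p-integral.\<close>

lemma val_ge_power_sum_diff_3:
  assumes n2: "n \<noteq> 2" and *: "p dvd n \<or> \<not> (p - 1) dvd (n - 2)"
  shows "val_ge p (3 * v) (of_int (power_sum n m) - of_nat m * bernoulli n)"
  unfolding power_sum_diff_bernoulli
proof (rule val_ge_sum[OF p])
  fix k assume k: "k \<in> {1..n}"
  consider "k = 1" | "k = 2" | "3 \<le> k" using k by fastforce
  then show "val_ge p (3 * v) (bernoulli_term n m k)"
  proof cases
    case 1
    have "bernoulli (n - 1) = 0"
      using n n2 by (intro bernoulli_odd_eq_0) auto
    then show ?thesis
      by (simp add: 1 bernoulli_term_def val_ge_0[OF p])
  next
    case 2
    show ?thesis
    proof (cases "p dvd n")
      case True
      have "even (n * (n - 1))" by (cases n) auto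
      then have "2 * (n choose 2) = n * (n - 1)"
        by (simp add: choose_two)
      then have "p dvd (n choose 2)"
        using True p not_dvd_2_3(1) by (metis dvd_mult2 prime_dvd_mult_iff)
      then obtain N where "n choose 2 = p * N" by blast
      then have eq: "bernoulli_term n m k =
          of_nat N * (of_nat p * bernoulli (n - 2)) * of_nat m ^ (k + 1) / of_nat (k + 1)"
        by (simp add: 2 bernoulli_term_def)
      show ?thesis
        unfolding eq using not_dvd_2_3 m val_ge_prime_mult_bernoulli 2
        by (intro val_ge_bernoulli_term[where s = 0 and v = v and j = 0 and c = 3]) auto
    next
      case False
      then have "val_ge p 0 (bernoulli (n - 2))"
        using * n n2 by (subst val_ge_bernoulli_iff) auto
      then show ?thesis
        unfolding bernoulli_term_def using not_dvd_2_3 m 2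
        by (intro val_ge_bernoulli_term[where s = 0 and v = v and j = 0 and c = 3]) auto
    qed
  qed (rule val_ge_bernoulli_term_ge_3)
qed

end

section \<open>The equivalence at one prime, and its globalization\<close>

lemma val_ge_bernoulli_iff_power_sum:
  assumes n: "0 < n" "even n" and r: "r = 1 \<or> r = 2"
    and m: "m = p ^ v * c" "\<not> p dvd c" "0 < v"
  shows "int p ^ ((r + 1) * v) dvd power_sum n m \<longleftrightarrow> val_ge p (r * v) (bernoulli n)"
proof -
  let ?S = "of_int (power_sum n m) :: rat"
  have dvd: "p ^ v dvd m" using m by simp
  have S_iff: "int p ^ e dvd power_sum n m \<longleftrightarrow> val_ge p e ?S" for e
    by (rule val_ge_of_int_iff[OF p, symmetric])
  have mB: "val_ge p (v + e) (of_nat m * bernoulli n) \<longleftrightarrow> val_ge p e (bernoulli n)" for e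
    unfolding m(1) by (rule val_ge_prime_power_mult_iff[OF p m(2)])
  show ?thesis
  proof (cases "(p - 1) dvd n")
    case True
    then have "\<not> val_ge p 0 (bernoulli n)"
      using val_ge_bernoulli_iff[OF n] by simp
    moreover from this have "\<not> val_ge p v ?S"
      using val_ge_diff_cong[OF p val_ge_power_sum_diff[OF n dvd m(3)]] mB[of 0] by simp
    moreover have "v \<le> (r + 1) * v" by simp
    ultimately show ?thesis
      unfolding S_iff using val_ge_mono[OF p] by (meson le0)
  next
    case False
    \<comment> \<open>For 2 and 3, \<open>p - 1\<close> would divide the even
      \<open>n\<close>.\<close>
    have "p \<noteq> 2" "p \<noteq> 3" "p \<noteq> 4"
      using False n p by auto
    then have p5: "5 \<le> p" using prime_ge_2_nat[OF p] by linarith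
    note E2 = val_ge_diff_cong[OF p val_ge_power_sum_diff_2[OF p5 n]]
    \<comment> \<open>\<open>n = 2\<close> belongs to the third case, as \<open>n - 2 = 0\<close>
      there.\<close>
    consider "r = 1" | "r = 2" "n \<noteq> 2" "p dvd n \<or> \<not> (p - 1) dvd (n - 2)"
      | "r = 2" "\<not> p dvd n" "(p - 1) dvd (n - 2)"
      using r nat_dvd_not_less[of 2 p] p5 by fastforce
    then show ?thesis
    proof cases
      case 1
      then show ?thesis
        unfolding S_iff using E2[OF dvd m(3)] mB[of v] by (simp add: mult_2)
    next
      case 2
      have "3 * v = v + 2 * v" by simp
      then show ?thesis
        unfolding S_iff
        using val_ge_diff_cong[OF p val_ge_power_sum_diff_3[OF p5 n dvd m(3) 2(2,3)]] mB[of "2 * v"] 2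
        by simp
    next
      case 3
      have "2 \<le> n" using n by presburger
      \<comment> \<open>Taking \<open>p\<close> for \<open>m\<close> shows that \<open>p\<close>
        does not divide \<open>bernoulli n\<close>; the general \<open>m\<close> follows by
        comparison modulo \<open>p ^ (2 * v)\<close>.\<close>
      then have "\<not> int p ^ 2 dvd power_sum n p"
        using not_square_dvd_power_sum[OF p p5 _ 3(3,2)] by simp
      then have "\<not> val_ge p (1 + 1) (of_nat (p ^ 1 * 1) * bernoulli n)"
        using E2[of 1 p] by (simp add: val_ge_of_int_iff[OF p] numeral_2_eq_2)
      then have "\<not> val_ge p 1 (bernoulli n)"
        using val_ge_prime_power_mult_iff[OF p, of 1 1 1] p5 by simp
      then have not_v: "\<not> val_ge p e (bernoulli n)" if "0 < e" for e
        using val_ge_mono[OF p, of e _ 1] that by auto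
      then have "\<not> val_ge p (2 * v) ?S"
        using E2[OF dvd m(3)] mB[of v] m(3) by (simp add: mult_2)
      then have "\<not> val_ge p ((r + 1) * v) ?S"
        using val_ge_mono[OF p, of "(r + 1) * v" ?S "2 * v"] 3(1) by auto
      then show ?thesis
        unfolding S_iff using not_v[of "r * v"] m(3) 3(1) by simp
    qed
  qed
qed

end

theorem theorem5p5:
  fixes n m r :: nat
  assumes "0 < n" and "0 < m" and "even n" and "r = 1 \<or> r = 2"
  shows "int m ^ (r + 1) dvd power_sum n m \<longleftrightarrow> int m ^ r dvd bernoulli_num n"
proof -
  have "int p ^ ((r + 1) * multiplicity p m) dvd power_sum n m \<longleftrightarrow>
      int p ^ (r * multiplicity p m) dvd bernoulli_num n" if "prime p" "p dvd m" for p
  proof -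
    have "m \<noteq> 0" "\<not> is_unit p" using assms(2) that by (auto simp: not_prime_unit)
    then obtain c where c: "m = p ^ multiplicity p m * c" "\<not> p dvd c"
      by (rule multiplicity_decompose')
    have v: "0 < multiplicity p m"
      using \<open>m \<noteq> 0\<close> \<open>\<not> is_unit p\<close> that by (simp add: multiplicity_gt_zero_iff)
    \<comment> \<open>A positive exponent lets divisibility of the numerator be read as a valuation
      bound.\<close>
    then have "0 < r * multiplicity p m" using assms(4) by auto
    from val_ge_iff_dvd_numerator[OF that(1) this, of "bernoulli n"] show ?thesis
      using val_ge_bernoulli_iff_power_sum[OF that(1) assms(1,3,4) c v]
      by (simp add: bernoulli_num_def)
  qed
  then show ?thesis
    unfolding power_dvd_iff_prime_powers[OF assms(2)] by blast
qed

end
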